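(* Let $p\in[0,3/4)$, let $S$ be the elephant random walk with memory parameter $p$, and let $R=\inf\{j\ge 1: S(j)=0\}$ be its first return time to the origin. Then $\mathbb{E}(R)<\infty$ if and only if $p<1/4$.
   Context: Elephant random walk with memory parameter $p$: let $X_1$ be uniform on $\{+1,-1\}$, and for $n\ge 1$ let $X_{n+1}=\varepsilon_n X_{u(n)}$, where $X_1,u(1),u(2),\ldots,\varepsilon_1,\varepsilon_2,\ldots$ are independent, $u(n)$ is uniform on $\{1,\ldots,n\}$ and $\mathbb{P}(\varepsilon_n=1)=p=1-\mathbb{P}(\varepsilon_n=-1)$. Then $S(0)=0$ and $S(n)=X_1+\cdots+X_n$. *)

theory Defs
  imports "HOL-Probability.Probability"
begin

text \<open>
  The sources of randomness are indexed by one type and all read as integers, because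
  \<^const>\<open>prob_space.indep_vars\<close> wants a single codomain type. \<open>Pick n\<close> and \<open>Flip n\<close> are only
  used for \<open>n \<ge> 1\<close>.
\<close>

datatype erw_source = Init | Pick nat | Flip nat

fun erw_source_var ::
  "(nat \<Rightarrow> 'a \<Rightarrow> int) \<Rightarrow> (nat \<Rightarrow> 'a \<Rightarrow> nat) \<Rightarrow> (nat \<Rightarrow> 'a \<Rightarrow> int) \<Rightarrow> erw_source \<Rightarrow> 'a \<Rightarrow> int" where
  "erw_source_var X u \<epsilon> Init = X 1"
| "erw_source_var X u \<epsilon> (Pick n) = (\<lambda>\<omega>. int (u n \<omega>))"
| "erw_source_var X u \<epsilon> (Flip n) = \<epsilon> n"

text \<open>
  \<open>X 0\<close>, \<open>u 0\<close> and \<open>\<epsilon> 0\<close> are unconstrained and irrelevant. The bounds \<open>0 \<le> p \<le> 1\<close> follow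
  from \<open>flip_pos\<close>.
\<close>

locale elephant_random_walk = prob_space M
  for M :: "'a measure" and p :: real
    and X :: "nat \<Rightarrow> 'a \<Rightarrow> int" and u :: "nat \<Rightarrow> 'a \<Rightarrow> nat" and \<epsilon> :: "nat \<Rightarrow> 'a \<Rightarrow> int" +
  assumes rv_step: "\<And>n. n \<ge> 1 \<Longrightarrow> random_variable (count_space UNIV) (X n)"
    and rv_pick: "\<And>n. n \<ge> 1 \<Longrightarrow> random_variable (count_space UNIV) (u n)"
    and rv_flip: "\<And>n. n \<ge> 1 \<Longrightarrow> random_variable (count_space UNIV) (\<epsilon> n)"
    and indep: "indep_vars (\<lambda>_. count_space UNIV) (erw_source_var X u \<epsilon>)
                  ({Init} \<union> Pick ` {1..} \<union> Flip ` {1..})"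
    and init: "distr M (count_space UNIV) (X 1) = measure_pmf (pmf_of_set {1, -1})"
    and pick: "\<And>n. n \<ge> 1 \<Longrightarrow> distr M (count_space UNIV) (u n) = measure_pmf (pmf_of_set {1..n})"
    and flip_pos: "\<And>n. n \<ge> 1 \<Longrightarrow> prob {\<omega> \<in> space M. \<epsilon> n \<omega> = 1} = p"
    and flip_neg: "\<And>n. n \<ge> 1 \<Longrightarrow> prob {\<omega> \<in> space M. \<epsilon> n \<omega> = -1} = 1 - p"
    and step: "\<And>n. n \<ge> 1 \<Longrightarrow> AE \<omega> in M. X (Suc n) \<omega> = \<epsilon> n \<omega> * X (u n \<omega>) \<omega>"

definition erw_position :: "(nat \<Rightarrow> 'a \<Rightarrow> int) \<Rightarrow> nat \<Rightarrow> 'a \<Rightarrow> int" where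
  "erw_position X n \<omega> = (\<Sum>i = 1..n. X i \<omega>)"

text \<open>The infimum is taken in \<^typ>\<open>enat\<close>, so it is \<open>\<infinity>\<close> if the origin is never revisited.\<close>

definition first_return :: "(nat \<Rightarrow> 'a \<Rightarrow> int) \<Rightarrow> 'a \<Rightarrow> enat" where
  "first_return S \<omega> = Inf {enat j | j. j \<ge> 1 \<and> S j \<omega> = 0}"

end

theory Submission
  imports Defs
begin

text \<open>
  Write \<open>a = 2 * p - 1\<close>. A uniformly chosen past step, kept with probability \<open>p\<close> and reversed
  otherwise, equals \<open>x\<close> (one of \<open>1\<close>, \<open>-1\<close>) with conditional probability \<open>(1 + a * x * S n / n) / 2\<close>:
  averaging over the past only sees its sum. So the position is a Markov chain whose drift at time
  \<open>n\<close> is \<open>a * S n / n\<close> (\<open>prob_history_Suc\<close>). Let \<open>r n\<close> be the probability that the walk has not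
  returned by time \<open>n\<close>, and let \<open>E n f\<close> be the expectation of \<open>f (S n)\<close> on that event
  (\<open>killed_exp\<close>). The mean of the return time is \<open>\<Sum>n. r n\<close>, so the question is
  whether this series converges. Since \<open>f 0 = 0\<close> makes the killing invisible, \<open>E (n + 1) f\<close> is
  \<open>E n\<close> of the one-step average of \<open>f\<close> (\<open>killed_exp_Suc\<close>), and three test functions decide.

  The diffusion analogue \<open>dY = dB + a * Y / t dt\<close> becomes, after multiplication by a power of \<open>t\<close>,
  a time-changed Brownian motion, which survives until \<open>t\<close> with probability of order
  \<open>t powr (a - 1 / 2)\<close>. This is integrable exactly when \<open>a < - 1 / 2\<close>, that is \<open>p < 1 / 4\<close>.

  Divergence for \<open>p \<ge> 1 / 4\<close>. Testing with \<open>\<bar>s\<bar>\<close> gives \<open>E (n + 1) \<bar>s\<bar> = (1 + a / n) * E n \<bar>s\<bar>\<close>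
  exactly. If \<open>a \<ge> 0\<close>, then \<open>1 \<le> E n \<bar>s\<bar> \<le> n * r n\<close>, and the harmonic series is a minorant. If
  \<open>- 1 / 2 \<le> a \<le> 0\<close>, then \<open>(E n \<bar>s\<bar>)\<^sup>2\<close> is at least a constant times \<open>1 / n\<close>, and by Cauchy-Schwarz
  at most \<open>E n (s\<^sup>2) * r n\<close>; but \<open>E (n + 1) (s\<^sup>2) \<le> E n (s\<^sup>2) + r n\<close>, so a convergent series
  \<open>\<Sum>n. r n\<close> would keep \<open>E n (s\<^sup>2)\<close> bounded and again dominate a multiple of the harmonic series.

  Convergence for \<open>p < 1 / 4\<close>. The function \<open>n powr (1 - \<gamma> / 2) * \<bar>s\<bar> powr \<gamma>\<close> is a Lyapunov function
  for every \<open>\<gamma> < 1\<close> with \<open>\<gamma> * (1 / 2 - a) > 1\<close>: its average decreases by at least a fixed \<open>c > 0\<close> in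
  each step away from the origin (\<open>lyapunov_drift\<close>). Hence \<open>c * (\<Sum>k\<ge>1. r k)\<close> is at most
  its initial value.
\<close>

section \<open>A Lyapunov function\<close>

lemma powr_le_Bernoulli:
  fixes t \<gamma> :: real
  assumes "0 \<le> \<gamma>" "\<gamma> \<le> 1" "0 \<le> 1 + t"
  shows "(1 + t) powr \<gamma> \<le> 1 + \<gamma> * t"
proof (cases "1 + t = 0")
  case True
  then have "t = -1" by simp
  then show ?thesis using assms by simp
next
  case False
  then show ?thesis
    using Youngs_inequality_0[of \<gamma> "1 - \<gamma>" "1 + t" 1] assms by (simp add: algebra_simps)
qed

text \<open>
  The quadratic gain over Bernoulli's inequality is what makes the Lyapunov function decrease while
  the walk is within distance \<open>sqrt n\<close> of the origin, where the drift is too weak to do so.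
\<close>

lemma powr_le_second_order:
  fixes t \<gamma> :: real
  assumes "0 < \<gamma>" "\<gamma> < 1" "0 \<le> t" "t \<le> 1"
  shows "(1 - t) powr \<gamma> \<le> 1 - \<gamma> * t - \<gamma> * (1 - \<gamma>) / 2 * t\<^sup>2"
proof (cases "t = 1")
  case True
  have "\<gamma> * (1 - \<gamma>) / 2 \<le> 1 * (1 - \<gamma>)"
    using mult_right_mono[of "\<gamma> / 2" 1 "1 - \<gamma>"] assms by simp
  then show ?thesis using True by simp
next
  case False
  define F where "F s = 1 - \<gamma> * s - \<gamma> * (1 - \<gamma>) / 2 * s\<^sup>2 - (1 - s) powr \<gamma>" for s
  have "F 0 \<le> F t"
  proof (rule DERIV_nonneg_imp_nondecreasing[OF \<open>0 \<le> t\<close>])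
    fix s assume s: "0 \<le> s" "s \<le> t"
    then have s1: "s < 1" using False assms by simp
    have "(F has_real_derivative
        (- \<gamma> - \<gamma> * (1 - \<gamma>) * s + \<gamma> * (1 - s) powr (\<gamma> - 1))) (at s)"
      unfolding F_def using s1
      by (auto intro!: derivative_eq_intros simp: powr_diff field_simps)
    moreover have "1 + (1 - \<gamma>) * s \<le> (1 - s) powr (\<gamma> - 1)"
    proof -
      have "(1 - s) powr (1 - \<gamma>) \<le> 1 - (1 - \<gamma>) * s"
        using powr_le_Bernoulli[of "1 - \<gamma>" "- s"] assms s1 by simp
      then have "(1 + (1 - \<gamma>) * s) * (1 - s) powr (1 - \<gamma>)
          \<le> (1 + (1 - \<gamma>) * s) * (1 - (1 - \<gamma>) * s)"
        using assms s by (intro mult_left_mono) auto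
      also have "\<dots> = 1 - ((1 - \<gamma>) * s)\<^sup>2"
        by (simp add: power2_eq_square algebra_simps)
      also have "\<dots> \<le> 1" by simp
      finally have "1 + (1 - \<gamma>) * s \<le> 1 / (1 - s) powr (1 - \<gamma>)"
        using s1 by (simp add: field_simps)
      also have "\<dots> = (1 - s) powr (\<gamma> - 1)"
        using powr_minus_divide[of "1 - s" "1 - \<gamma>"] by simp
      finally show ?thesis .
    qed
    then have "0 \<le> \<gamma> * ((1 - s) powr (\<gamma> - 1) - (1 + (1 - \<gamma>) * s))"
      using assms by simp
    then have "0 \<le> - \<gamma> - \<gamma> * (1 - \<gamma>) * s + \<gamma> * (1 - s) powr (\<gamma> - 1)"
      by (simp add: algebra_simps)
    ultimately show "\<exists>y. (F has_real_derivative y) (at s) \<and> 0 \<le> y" by blast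
  qed
  then show ?thesis by (simp add: F_def)
qed

text \<open>
  To leading order the relative change of \<open>n powr (1 - \<gamma> / 2) * x powr \<gamma>\<close> in a step is
  \<open>(1 - \<gamma> / 2 + \<gamma> * a) / n\<close>, from the growth of the time factor and from the drift, minus
  \<open>\<gamma> * (1 - \<gamma>) / 2 / x\<^sup>2\<close>, from the concavity in \<open>x\<close>. Both contributions are negative; the first
  amounts to a fixed decrease when \<open>x\<^sup>2 \<ge> n\<close> and the second when \<open>x\<^sup>2 \<le> n\<close>.
  Bounding the upward move by its tangent alone halves the concavity constant, but needs no
  lower bound on \<open>(x + 1) powr \<gamma> - (x - 1) powr \<gamma>\<close>.
\<close>

lemma lyapunov_drift:
  fixes a \<gamma> x :: real and n :: nat
  assumes a: "-1 \<le> a" "a \<le> 0" and \<gamma>: "0 < \<gamma>" "\<gamma> < 1" and x: "1 \<le> x" "x \<le> n"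
  and \<delta>: "1 < \<gamma> * (1 / 2 - a)"
  shows "real (Suc n) powr (1 - \<gamma> / 2) *
           ((1 + a * x / n) / 2 * (x + 1) powr \<gamma> + (1 - a * x / n) / 2 * (x - 1) powr \<gamma>)
         \<le> real n powr (1 - \<gamma> / 2) * x powr \<gamma>
           - min (\<gamma> * (1 / 2 - a) - 1) (\<gamma> * (1 - \<gamma>) / 4)"
proof -
  define \<eta> where "\<eta> = 1 - \<gamma> / 2"
  define c where "c = \<gamma> * (1 - \<gamma>) / 4"
  define \<delta> where "\<delta> = \<gamma> * (1 / 2 - a) - 1"
  define t where "t = 1 / x"
  define b where "b = a * x / n"
  have n: "1 \<le> real n" using x by simp
  have t: "0 < t" "t \<le> 1" using x by (auto simp: t_def)
  have c: "0 < c" using \<gamma> by (simp add: c_def)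
  have "(- a) * x \<le> 1 * real n" using a x by (intro mult_mono) auto
  then have b: "-1 \<le> b" "b \<le> 0"
    using a x n by (auto simp: b_def field_simps mult_nonneg_nonpos2 mult_nonpos_nonneg)
  have bt: "b * t = a / n" using x by (simp add: b_def t_def)
  have up: "(x + 1) powr \<gamma> = x powr \<gamma> * (1 + t) powr \<gamma>"
  proof -
    have "x + 1 = x * (1 + t)" using x by (simp add: t_def field_simps)
    then show ?thesis using x t by (simp add: powr_mult)
  qed
  have dn: "(x - 1) powr \<gamma> = x powr \<gamma> * (1 - t) powr \<gamma>"
  proof -
    have "x - 1 = x * (1 - t)" using x by (simp add: t_def field_simps)
    then show ?thesis using x t by (simp add: powr_mult)
  qed
  have nn: "real (Suc n) powr \<eta> \<le> real n powr \<eta> * (1 + \<eta> / n)"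
  proof -
    have "real (Suc n) = real n * (1 + 1 / n)" using n by (simp add: field_simps)
    then have "real (Suc n) powr \<eta> = real n powr \<eta> * (1 + 1 / n) powr \<eta>"
      using n by (simp only: powr_mult)
    moreover have "(1 + 1 / n) powr \<eta> \<le> 1 + \<eta> * (1 / n)"
      using \<gamma> by (intro powr_le_Bernoulli) (auto simp: \<eta>_def)
    ultimately show ?thesis by (simp add: mult_left_mono)
  qed
  have bracket: "(1 + b) / 2 * (1 + t) powr \<gamma> + (1 - b) / 2 * (1 - t) powr \<gamma>
      \<le> 1 + \<gamma> * a / n - c * t\<^sup>2"
  proof -
    have "(1 + b) / 2 * (1 + t) powr \<gamma> \<le> (1 + b) / 2 * (1 + \<gamma> * t)"
      using powr_le_Bernoulli[of \<gamma> t] \<gamma> t b by (intro mult_left_mono) auto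
    moreover have "(1 - b) / 2 * (1 - t) powr \<gamma> \<le> (1 - b) / 2 * (1 - \<gamma> * t - 2 * c * t\<^sup>2)"
      using powr_le_second_order[of \<gamma> t] \<gamma> t b by (intro mult_left_mono) (auto simp: c_def)
    moreover have "(1 + b) / 2 * (1 + \<gamma> * t) + (1 - b) / 2 * (1 - \<gamma> * t - 2 * c * t\<^sup>2)
        = 1 + \<gamma> * (b * t) - c * t\<^sup>2 + b * (c * t\<^sup>2)"
      by (simp add: field_simps)
    moreover have "b * (c * t\<^sup>2) \<le> 0" using b c by (simp add: mult_nonpos_nonneg)
    ultimately show ?thesis unfolding bt by simp
  qed
  have "real (Suc n) powr \<eta> * ((1 + b) / 2 * (x + 1) powr \<gamma> + (1 - b) / 2 * (x - 1) powr \<gamma>)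
      = real (Suc n) powr \<eta> * (x powr \<gamma> *
          ((1 + b) / 2 * (1 + t) powr \<gamma> + (1 - b) / 2 * (1 - t) powr \<gamma>))"
    unfolding up dn by (simp add: algebra_simps)
  also have "\<dots> \<le> (real n powr \<eta> * (1 + \<eta> / n)) * (x powr \<gamma> *
          ((1 + b) / 2 * (1 + t) powr \<gamma> + (1 - b) / 2 * (1 - t) powr \<gamma>))"
    using b by (intro mult_right_mono[OF nn]) auto
  also have "\<dots> \<le> (real n powr \<eta> * (1 + \<eta> / n)) * (x powr \<gamma> * (1 + \<gamma> * a / n - c * t\<^sup>2))"
    using \<gamma> n by (intro mult_left_mono bracket) (auto simp: \<eta>_def)
  also have "\<dots> = real n powr \<eta> * x powr \<gamma> * ((1 + \<eta> / n) * (1 + \<gamma> * a / n - c * t\<^sup>2))"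
    by simp
  also have "\<dots> \<le> real n powr \<eta> * x powr \<gamma> * (1 - \<delta> / n - c * t\<^sup>2)"
  proof (rule mult_left_mono)
    have "\<eta> / n * (\<gamma> * a / n - c * t\<^sup>2) \<le> 0"
      using \<gamma> a c n by (intro mult_nonneg_nonpos)
        (auto simp: \<eta>_def mult_nonneg_nonpos divide_nonpos_nonneg intro: order_trans[OF _ mult_nonneg_nonneg])
    moreover have "(1 + \<eta> / n) * (1 + \<gamma> * a / n - c * t\<^sup>2)
        = 1 + (\<eta> + \<gamma> * a) / n - c * t\<^sup>2 + \<eta> / n * (\<gamma> * a / n - c * t\<^sup>2)"
      by (simp add: algebra_simps add_divide_distrib)
    moreover have "\<eta> + \<gamma> * a = - \<delta>" by (simp add: \<eta>_def \<delta>_def algebra_simps)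
    ultimately show "(1 + \<eta> / n) * (1 + \<gamma> * a / n - c * t\<^sup>2) \<le> 1 - \<delta> / n - c * t\<^sup>2"
      by simp
  qed simp
  also have "\<dots> = real n powr \<eta> * x powr \<gamma> -
      (\<delta> * (real n powr \<eta> * x powr \<gamma> / n) + c * (real n powr \<eta> * x powr \<gamma> / x\<^sup>2))"
    by (simp add: t_def algebra_simps power_divide)
  also have "\<dots> \<le> real n powr \<eta> * x powr \<gamma> - min \<delta> c"
  proof -
    \<comment> \<open>With \<open>y = x\<^sup>2 / n\<close> the two quotients are \<open>y powr (\<gamma> / 2)\<close> and \<open>y powr (\<gamma> / 2 - 1)\<close>;
      one of them is at least 1.\<close>
    define y where "y = x\<^sup>2 / n"
    have y: "0 < y" using x n by (simp add: y_def)
    have x2: "x powr \<gamma> = (x\<^sup>2) powr (\<gamma> / 2)"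
      using x by (simp add: powr_powr flip: powr_numeral)
    have yp: "y powr (\<gamma> / 2) = x powr \<gamma> / n powr (\<gamma> / 2)"
      using x by (simp add: y_def powr_divide x2)
    have q1: "real n powr \<eta> * x powr \<gamma> / n = y powr (\<gamma> / 2)"
      using n by (simp add: \<eta>_def powr_diff yp)
    have q2: "real n powr \<eta> * x powr \<gamma> / x\<^sup>2 = y powr (\<gamma> / 2) / y"
      unfolding yp using n x by (simp add: \<eta>_def powr_diff y_def)
    have "min \<delta> c \<le> \<delta> * y powr (\<gamma> / 2) + c * (y powr (\<gamma> / 2) / y)"
    proof (cases "1 \<le> y")
      case True
      then have "1 \<le> y powr (\<gamma> / 2)" using \<gamma> by (simp add: ge_one_powr_ge_zero)
      then have "\<delta> * 1 \<le> \<delta> * y powr (\<gamma> / 2)" using \<delta> by (intro mult_left_mono) (auto simp: \<delta>_def)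
      moreover have "0 \<le> c * (y powr (\<gamma> / 2) / y)" using c y by simp
      ultimately show ?thesis by linarith
    next
      case False
      have "y powr 1 \<le> y powr (\<gamma> / 2)" using False y \<gamma> by (intro powr_mono') auto
      then have "1 \<le> y powr (\<gamma> / 2) / y" using y by (simp add: field_simps)
      then have "c * 1 \<le> c * (y powr (\<gamma> / 2) / y)" using c by (intro mult_left_mono) auto
      moreover have "0 \<le> \<delta> * y powr (\<gamma> / 2)" using \<delta> by (simp add: \<delta>_def)
      ultimately show ?thesis by linarith
    qed
    then show ?thesis unfolding q1 q2 by simp
  qed
  finally show ?thesis unfolding b_def \<eta>_def \<delta>_def c_def .
qed

section \<open>The law of the history\<close>

text \<open>
  The first \<open>n\<close> steps as a function of the independent sources, which makes the independence of the
  past from \<open>Pick n\<close> and \<open>Flip n\<close> visible. List positions count from 0, steps from 1.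
\<close>

primrec rebuild :: "nat \<Rightarrow> (erw_source \<Rightarrow> int) \<Rightarrow> int list" where
  "rebuild 0 s = []"
| "rebuild (Suc n) s = rebuild n s @
     [if n = 0 then s Init else s (Flip n) * rebuild n s ! (nat (s (Pick n)) - 1)]"

definition sources :: "nat \<Rightarrow> erw_source set" where
  "sources n = {Init} \<union> Pick ` {1..<n} \<union> Flip ` {1..<n}"

lemma length_rebuild [simp]: "length (rebuild n s) = n"
  by (induction n) auto

lemma rebuild_cong:
  "(\<And>i. i \<in> sources n \<Longrightarrow> s i = s' i) \<Longrightarrow> rebuild n s = rebuild n s'"
proof (induction n)
  case (Suc n)
  have "rebuild n s = rebuild n s'"
    using Suc.prems by (intro Suc.IH) (auto simp: sources_def)
  moreover have "s Init = s' Init" using Suc.prems by (auto simp: sources_def)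
  moreover have "s (Flip n) = s' (Flip n) \<and> s (Pick n) = s' (Pick n)" if "n \<noteq> 0"
    using Suc.prems that by (auto simp: sources_def)
  ultimately show ?case by simp
qed simp

lemma measurable_rebuild:
  assumes "sources n \<subseteq> A"
  shows "rebuild n \<in> measurable (PiM A (\<lambda>_. count_space UNIV)) (count_space UNIV)"
  using assms
proof (induction n)
  case (Suc n)
  have src: "(\<lambda>s. s i) \<in> measurable (PiM A (\<lambda>_. count_space UNIV)) (count_space (UNIV :: int set))"
    if "i \<in> A" for i
    using that by (rule measurable_component_singleton)
  have [measurable]: "rebuild n \<in> measurable (PiM A (\<lambda>_. count_space UNIV)) (count_space UNIV)"
    using Suc.prems by (intro Suc.IH) (auto simp: sources_def)
  have [measurable]: "(\<lambda>s. s Init) \<in> measurable (PiM A (\<lambda>_. count_space UNIV)) (count_space (UNIV :: int set))"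
    using Suc.prems by (intro src) (auto simp: sources_def)
  show ?case
  proof (cases "n = 0")
    case True
    then show ?thesis by simp
  next
    case False
    have [measurable]: "(\<lambda>s. s (Flip n)) \<in> measurable (PiM A (\<lambda>_. count_space UNIV)) (count_space (UNIV :: int set))"
      "(\<lambda>s. s (Pick n)) \<in> measurable (PiM A (\<lambda>_. count_space UNIV)) (count_space (UNIV :: int set))"
      using Suc.prems False by (auto intro!: src simp: sources_def)
    show ?thesis using False by simp
  qed
next
  case 0
  have "rebuild 0 = (\<lambda>_. [])" by (rule ext) simp
  then show ?case by simp
qed

context elephant_random_walk
begin

abbreviation src :: "'a \<Rightarrow> erw_source \<Rightarrow> int" where
  "src \<omega> \<equiv> \<lambda>i. erw_source_var X u \<epsilon> i \<omega>"

definition history :: "nat \<Rightarrow> 'a \<Rightarrow> int list" where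
  "history n \<omega> = map (\<lambda>i. X (Suc i) \<omega>) [0..<n]"

lemma length_history [simp]: "length (history n \<omega>) = n"
  by (simp add: history_def)

lemma history_Suc: "history (Suc n) \<omega> = history n \<omega> @ [X (Suc n) \<omega>]"
  by (simp add: history_def)

lemma take_history: "j \<le> n \<Longrightarrow> take j (history n \<omega>) = history j \<omega>"
  by (simp add: history_def take_map)

lemma sum_list_history: "sum_list (history n \<omega>) = erw_position X n \<omega>"
  by (induction n) (auto simp: history_Suc erw_position_def history_def)

lemma measurable_history [measurable]: "history n \<in> measurable M (count_space UNIV)"
proof (induction n)
  case (Suc n)
  note [measurable] = Suc rv_step[of "Suc n", simplified]
  have "(\<lambda>\<omega>. history n \<omega> @ [X (Suc n) \<omega>]) \<in> measurable M (count_space UNIV)"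
    by measurable
  then show ?case by (simp add: history_Suc[abs_def])
qed (simp add: history_def)

lemma AE_flip: "n \<ge> 1 \<Longrightarrow> AE \<omega> in M. \<epsilon> n \<omega> \<in> {1, -1}"
proof -
  assume n: "n \<ge> 1"
  note [measurable] = rv_flip[OF n]
  have "prob {\<omega> \<in> space M. \<epsilon> n \<omega> \<in> {1, -1}}
      = prob ({\<omega> \<in> space M. \<epsilon> n \<omega> = 1} \<union> {\<omega> \<in> space M. \<epsilon> n \<omega> = -1})"
    by (rule arg_cong[where f = prob]) auto
  also have "\<dots> = prob {\<omega> \<in> space M. \<epsilon> n \<omega> = 1} + prob {\<omega> \<in> space M. \<epsilon> n \<omega> = -1}"
    by (rule finite_measure_Union) auto
  also have "\<dots> = 1" using flip_pos[OF n] flip_neg[OF n] by simp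
  finally show ?thesis
    by (subst (asm) prob_Collect_eq_1) auto
qed

lemma prob_pick:
  assumes "n \<ge> 1"
  shows "prob {\<omega> \<in> space M. u n \<omega> = k} = (if k \<in> {1..n} then 1 / n else 0)"
proof -
  note [measurable] = rv_pick[OF assms]
  have "prob {\<omega> \<in> space M. u n \<omega> = k} = measure (distr M (count_space UNIV) (u n)) {k}"
    by (subst measure_distr) (auto intro!: arg_cong[where f = prob])
  also have "\<dots> = pmf (pmf_of_set {1..n}) k"
    by (simp add: pick[OF assms] pmf.rep_eq)
  finally show ?thesis using assms by (simp add: indicator_def)
qed

lemma prob_init:
  "prob {\<omega> \<in> space M. X 1 \<omega> = x} = (if x \<in> {1, -1} then 1 / 2 else 0)"
proof -
  note [measurable] = rv_step[of 1, simplified]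
  have "prob {\<omega> \<in> space M. X 1 \<omega> = x} = measure (distr M (count_space UNIV) (X 1)) {x}"
    by (subst measure_distr) (auto intro!: arg_cong[where f = prob])
  also have "\<dots> = pmf (pmf_of_set {1, -1}) x"
    unfolding init by (simp add: pmf.rep_eq)
  finally show ?thesis by (auto simp: indicator_def)
qed

lemma AE_pick:
  assumes "n \<ge> 1"
  shows "AE \<omega> in M. u n \<omega> \<in> {1..n}"
proof -
  note [measurable] = rv_pick[OF assms]
  have "AE k in distr M (count_space UNIV) (u n). k \<in> {1..n}"
    unfolding pick[OF assms] using assms by (simp add: AE_measure_pmf_iff)
  then show ?thesis by (subst (asm) AE_distr_iff) auto
qed

lemma AE_init: "AE \<omega> in M. X 1 \<omega> \<in> {1, -1}"
proof -
  note [measurable] = rv_step[of 1, simplified]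
  have "AE k in distr M (count_space UNIV) (X 1). k \<in> {1, -1}"
    unfolding init by (simp add: AE_measure_pmf_iff)
  then show ?thesis by (subst (asm) AE_distr_iff) auto
qed

lemma AE_history_Suc:
  assumes "n \<ge> 1"
  shows "AE \<omega> in M. u n \<omega> \<in> {1..n} \<and> \<epsilon> n \<omega> \<in> {1, -1} \<and>
           X (Suc n) \<omega> = \<epsilon> n \<omega> * history n \<omega> ! (u n \<omega> - 1)"
  using step[OF assms] AE_pick[OF assms] AE_flip[OF assms]
  by eventually_elim (auto simp: history_def)

lemma AE_history_rebuild: "AE \<omega> in M. history n \<omega> = rebuild n (src \<omega>)"
proof (induction n)
  case (Suc n)
  show ?case
  proof (cases "n = 0")
    case True
    then show ?thesis by (simp add: history_def)
  next
    case False
    then have "n \<ge> 1" by simp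
    from Suc AE_history_Suc[OF this] show ?thesis
      by eventually_elim (use False in \<open>auto simp: history_Suc\<close>)
  qed
qed (simp add: history_def)

lemma AE_history_signs: "AE \<omega> in M. set (history n \<omega>) \<subseteq> {1, -1}"
proof (induction n)
  case (Suc n)
  show ?case
  proof (cases "n = 0")
    case True
    then show ?thesis using AE_init by (simp add: history_def)
  next
    case False
    then have n: "n \<ge> 1" by simp
    from Suc AE_history_Suc[OF n] show ?thesis
    proof eventually_elim
      case (elim \<omega>)
      then have "history n \<omega> ! (u n \<omega> - 1) \<in> set (history n \<omega>)"
        by (intro nth_mem) auto
      then have "history n \<omega> ! (u n \<omega> - 1) \<in> {1, -1}" using elim by blast
      then show ?case using elim by (auto simp: history_Suc)
    qed
  qed
qed (simp add: history_def)

lemma measurable_src: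
  assumes "i \<in> {Init} \<union> Pick ` {1..} \<union> Flip ` {1..}"
  shows "(\<lambda>\<omega>. src \<omega> i) \<in> measurable M (count_space UNIV)"
  using indep assms unfolding indep_vars_def by (auto simp del: erw_source_var.simps)

text \<open>
  Independence of families wants one codomain for both sides, so the two blocks of sources are
  observed through predicates.
\<close>

lemma indep_sources_prob:
  assumes "A \<inter> B = {}" "A \<union> B \<subseteq> {Init} \<union> Pick ` {1..} \<union> Flip ` {1..}"
    and F: "Measurable.pred (PiM A (\<lambda>_. count_space UNIV)) F"
    and G: "Measurable.pred (PiM B (\<lambda>_. count_space UNIV)) G"
  shows "prob {\<omega> \<in> space M. F (restrict (src \<omega>) A) \<and> G (restrict (src \<omega>) B)} =
         prob {\<omega> \<in> space M. F (restrict (src \<omega>) A)} *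
         prob {\<omega> \<in> space M. G (restrict (src \<omega>) B)}"
proof -
  have "indep_var (count_space UNIV) (F \<circ> (\<lambda>\<omega>. restrict (src \<omega>) A))
          (count_space UNIV) (G \<circ> (\<lambda>\<omega>. restrict (src \<omega>) B))"
    using assms by (intro indep_var_compose[OF indep_var_restrict[OF indep] F G]) auto
  from indep_varD[OF this, of "{True}" "{True}"] show ?thesis
    by (auto simp: vimage_def Int_def conj_commute)
qed

lemma prob_history_pick_flip:
  assumes n: "n \<ge> 1"
  shows "prob {\<omega> \<in> space M. history n \<omega> = h \<and> u n \<omega> = k \<and> \<epsilon> n \<omega> = e} =
         prob {\<omega> \<in> space M. history n \<omega> = h} * prob {\<omega> \<in> space M. u n \<omega> = k} *
         prob {\<omega> \<in> space M. \<epsilon> n \<omega> = e}"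
proof -
  note [measurable] = rv_pick[OF n] rv_flip[OF n]
  define A where "A = sources n"
  have disj: "Pick n \<notin> A" "Flip n \<notin> A" by (auto simp: A_def sources_def)
  have sub: "A \<subseteq> {Init} \<union> Pick ` {1..} \<union> Flip ` {1..}" by (auto simp: A_def sources_def)
  have reb: "rebuild n (restrict (src \<omega>) B) = rebuild n (src \<omega>)" if "A \<subseteq> B" for \<omega> B
    using that by (intro rebuild_cong) (auto simp: A_def)
  have [measurable]: "(\<lambda>\<omega>. rebuild n (src \<omega>)) \<in> measurable M (count_space UNIV)"
  proof -
    have "(\<lambda>\<omega>. restrict (src \<omega>) A) \<in> measurable M (PiM A (\<lambda>_. count_space UNIV))"
      using sub by (intro measurable_restrict measurable_src) auto
    from measurable_compose[OF this measurable_rebuild[of n A]] show ?thesis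
      by (simp add: reb A_def)
  qed
  have single: "(\<lambda>s. s i) \<in> measurable (PiM B (\<lambda>_. count_space UNIV)) (count_space (UNIV :: int set))"
    if "i \<in> B" for i B
    using that by (rule measurable_component_singleton)
  have "prob {\<omega> \<in> space M. history n \<omega> = h \<and> u n \<omega> = k \<and> \<epsilon> n \<omega> = e}
      = prob {\<omega> \<in> space M. rebuild n (src \<omega>) = h \<and> u n \<omega> = k \<and> \<epsilon> n \<omega> = e}"
    by (rule finite_measure_eq_AE)
      (use AE_history_rebuild[of n] in \<open>eventually_elim; simp\<close>, measurable)
  also have "\<dots> = prob {\<omega> \<in> space M.
        (\<lambda>s. rebuild n s = h \<and> s (Pick n) = int k) (restrict (src \<omega>) (insert (Pick n) A)) \<and>
        (\<lambda>s. s (Flip n) = e) (restrict (src \<omega>) {Flip n})}"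
    by (intro arg_cong[where f = prob]) (auto simp: reb subset_insertI)
  also have "\<dots> = prob {\<omega> \<in> space M.
        (\<lambda>s. rebuild n s = h \<and> s (Pick n) = int k) (restrict (src \<omega>) (insert (Pick n) A))} *
        prob {\<omega> \<in> space M. (\<lambda>s. s (Flip n) = e) (restrict (src \<omega>) {Flip n})}"
  proof (rule indep_sources_prob)
    have [measurable]: "rebuild n \<in> measurable (PiM (insert (Pick n) A) (\<lambda>_. count_space UNIV)) (count_space UNIV)"
      "(\<lambda>s. s (Pick n)) \<in> measurable (PiM (insert (Pick n) A) (\<lambda>_. count_space UNIV)) (count_space (UNIV :: int set))"
      by (auto intro!: measurable_rebuild single simp: A_def)
    show "Measurable.pred (PiM (insert (Pick n) A) (\<lambda>_. count_space UNIV))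
        (\<lambda>s. rebuild n s = h \<and> s (Pick n) = int k)"
      by measurable
    have [measurable]: "(\<lambda>s. s (Flip n)) \<in> measurable (PiM {Flip n} (\<lambda>_. count_space UNIV)) (count_space (UNIV :: int set))"
      by (intro single) simp
    show "Measurable.pred (PiM {Flip n} (\<lambda>_. count_space UNIV)) (\<lambda>s. s (Flip n) = e)"
      by measurable
  qed (use disj sub n in auto)
  also have "{\<omega> \<in> space M.
        (\<lambda>s. rebuild n s = h \<and> s (Pick n) = int k) (restrict (src \<omega>) (insert (Pick n) A))}
      = {\<omega> \<in> space M. (\<lambda>s. rebuild n s = h) (restrict (src \<omega>) A) \<and>
          (\<lambda>s. s (Pick n) = int k) (restrict (src \<omega>) {Pick n})}"
    by (auto simp: reb subset_insertI)
  also have "prob \<dots> = prob {\<omega> \<in> space M. (\<lambda>s. rebuild n s = h) (restrict (src \<omega>) A)} *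
      prob {\<omega> \<in> space M. (\<lambda>s. s (Pick n) = int k) (restrict (src \<omega>) {Pick n})}"
  proof (rule indep_sources_prob)
    have [measurable]: "rebuild n \<in> measurable (PiM A (\<lambda>_. count_space UNIV)) (count_space UNIV)"
      "(\<lambda>s. s (Pick n)) \<in> measurable (PiM {Pick n} (\<lambda>_. count_space UNIV)) (count_space (UNIV :: int set))"
      by (auto intro!: measurable_rebuild single simp: A_def)
    show "Measurable.pred (PiM A (\<lambda>_. count_space UNIV)) (\<lambda>s. rebuild n s = h)"
      "Measurable.pred (PiM {Pick n} (\<lambda>_. count_space UNIV)) (\<lambda>s. s (Pick n) = int k)"
      by measurable
  qed (use disj sub n in auto)
  also have "prob {\<omega> \<in> space M. (\<lambda>s. rebuild n s = h) (restrict (src \<omega>) A)}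
      = prob {\<omega> \<in> space M. history n \<omega> = h}"
    unfolding reb[OF order_refl]
    by (rule finite_measure_eq_AE)
      (use AE_history_rebuild[of n] in \<open>eventually_elim; simp\<close>, measurable)
  finally show ?thesis by simp
qed

text \<open>
  The Markov property. Given the past \<open>h\<close>, the next step is \<open>x\<close> when some \<open>k\<close> is picked and the flip
  is \<open>x * h ! (k - 1)\<close>, which has probability \<open>(1 + (2 * p - 1) * x * h ! (k - 1)) / 2\<close>. This is affine in
  the picked entry, so averaging over \<open>k\<close> leaves only the sum of \<open>h\<close>.
\<close>

lemma prob_history_Suc:
  assumes n: "n \<ge> 1" and h: "length h = n" "set h \<subseteq> {1, -1}" and x: "x \<in> {1, -1}"
  shows "prob {\<omega> \<in> space M. history (Suc n) \<omega> = h @ [x]} =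
         prob {\<omega> \<in> space M. history n \<omega> = h} *
           ((1 + (2 * p - 1) * (x * sum_list h) / n) / 2)"
proof -
  note [measurable] = rv_pick[OF n] rv_flip[OF n]
  define E where "E k = {\<omega> \<in> space M. history n \<omega> = h \<and> u n \<omega> = k \<and> \<epsilon> n \<omega> = x * h ! (k - 1)}" for k
  have sgn: "h ! (k - 1) \<in> {1, -1}" if "k \<in> {1..n}" for k
    using nth_mem[of "k - 1" h] that h by force
  have "prob {\<omega> \<in> space M. history (Suc n) \<omega> = h @ [x]} = prob (\<Union>k\<in>{1..n}. E k)"
  proof (rule finite_measure_eq_AE)
    show "AE \<omega> in M. (\<omega> \<in> {\<omega> \<in> space M. history (Suc n) \<omega> = h @ [x]}) = (\<omega> \<in> (\<Union>k\<in>{1..n}. E k))"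
      using AE_history_Suc[OF n]
    proof eventually_elim
      case (elim \<omega>)
      have "\<epsilon> n \<omega> * h ! (u n \<omega> - 1) = x \<longleftrightarrow> \<epsilon> n \<omega> = x * h ! (u n \<omega> - 1)"
        using sgn[of "u n \<omega>"] elim x by auto
      then show ?case using elim by (auto simp: history_Suc E_def)
    qed
  qed (auto simp: E_def)
  also have "\<dots> = (\<Sum>k\<in>{1..n}. prob (E k))"
    by (rule finite_measure_finite_Union) (auto simp: E_def disjoint_family_on_def)
  also have "\<dots> = (\<Sum>k\<in>{1..n}. prob {\<omega> \<in> space M. history n \<omega> = h} * (1 / n) *
                  ((1 + (2 * p - 1) * (x * h ! (k - 1))) / 2))"
  proof (rule sum.cong[OF refl])
    fix k assume k: "k \<in> {1..n}"
    have "prob {\<omega> \<in> space M. \<epsilon> n \<omega> = x * h ! (k - 1)} = (1 + (2 * p - 1) * (x * h ! (k - 1))) / 2"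
      using sgn[OF k] x flip_pos[OF n] flip_neg[OF n] by (auto simp: field_simps)
    then show "prob (E k) = prob {\<omega> \<in> space M. history n \<omega> = h} * (1 / n) *
                  ((1 + (2 * p - 1) * (x * h ! (k - 1))) / 2)"
      using k unfolding E_def prob_history_pick_flip[OF n] prob_pick[OF n] by (simp only: if_True)
  qed
  also have "\<dots> = prob {\<omega> \<in> space M. history n \<omega> = h} * (1 / n) *
      ((n + (2 * p - 1) * (x * (\<Sum>k\<in>{1..n}. h ! (k - 1)))) / 2)"
  proof -
    have "(\<Sum>k\<in>{1..n}. (1 + (2 * p - 1) * (x * h ! (k - 1))) / 2)
        = (n + (2 * p - 1) * (x * (\<Sum>k\<in>{1..n}. h ! (k - 1)))) / 2"
      by (simp add: sum.distrib sum_distrib_left flip: sum_divide_distrib)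
    then show ?thesis by (simp only: flip: sum_distrib_left)
  qed
  also have "(\<Sum>k\<in>{1..n}. h ! (k - 1)) = sum_list h"
    unfolding sum_list_sum_nth using h
    by (intro sum.reindex_bij_witness[of _ Suc "\<lambda>k. k - 1"]) auto
  finally show ?thesis using n by (simp add: field_simps)
qed

section \<open>Expectations before the return to the origin\<close>

definition alive :: "nat \<Rightarrow> int list set" where
  "alive n = {h. length h = n \<and> set h \<subseteq> {1, -1} \<and> (\<forall>j\<in>{1..n}. sum_list (take j h) \<noteq> 0)}"

lemma finite_alive: "finite (alive n)"
  using finite_lists_length_eq[of "{1, -1 :: int}" n]
  by (rule rev_finite_subset) (auto simp: alive_def)

lemma alive_0 [simp]: "alive 0 = {[]}"
  by (auto simp: alive_def)

lemma alive_Suc: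
  "alive (Suc n) = (\<lambda>(h, x). h @ [x]) ` {(h, x) \<in> alive n \<times> {1, -1}. sum_list h + x \<noteq> 0}"
proof (intro equalityI subsetI)
  fix g assume g: "g \<in> alive (Suc n)"
  then have "g \<noteq> []" by (auto simp: alive_def)
  then obtain h x where gx: "g = h @ [x]" by (cases g rule: rev_cases) auto
  have "sum_list (take j h) \<noteq> 0" if "j \<in> {1..n}" for j
    using g that by (auto simp: alive_def gx dest!: bspec[of _ _ j])
  moreover have "sum_list h + x \<noteq> 0"
    using g by (auto simp: alive_def gx dest!: bspec[of _ _ "Suc n"])
  ultimately show "g \<in> (\<lambda>(h, x). h @ [x]) ` {(h, x) \<in> alive n \<times> {1, -1}. sum_list h + x \<noteq> 0}"
    using g by (auto simp: alive_def gx image_iff)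
qed (auto simp: alive_def le_Suc_eq)

lemma abs_sum_list_alive:
  assumes "h \<in> alive n"
  shows "\<bar>sum_list h\<bar> \<le> int n"
proof -
  have "\<bar>sum_list h\<bar> \<le> int (length h)" if "set h \<subseteq> {1, -1}" for h :: "int list"
    using that by (induction h) auto
  then show ?thesis using assms by (auto simp: alive_def)
qed

definition killed_exp :: "nat \<Rightarrow> (int \<Rightarrow> real) \<Rightarrow> real" where
  "killed_exp n f = (\<Sum>h\<in>alive n. prob {\<omega> \<in> space M. history n \<omega> = h} * f (sum_list h))"

text \<open>
  Integrands need to be compared only at values that the walk can take before it returns.
\<close>

lemma killed_exp_mono:
  assumes "n \<ge> 1" "\<And>s. s \<noteq> 0 \<Longrightarrow> \<bar>s\<bar> \<le> int n \<Longrightarrow> f s \<le> g s"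
  shows "killed_exp n f \<le> killed_exp n g"
  unfolding killed_exp_def
proof (intro sum_mono mult_left_mono assms(2) abs_sum_list_alive)
  fix h assume "h \<in> alive n"
  then show "sum_list h \<noteq> 0" using assms(1) by (auto simp: alive_def dest!: bspec[of _ _ n])
qed auto

lemma killed_exp_cong:
  assumes "n \<ge> 1" "\<And>s. s \<noteq> 0 \<Longrightarrow> \<bar>s\<bar> \<le> int n \<Longrightarrow> f s = g s"
  shows "killed_exp n f = killed_exp n g"
  using assms by (intro antisym killed_exp_mono) auto

lemma killed_exp_nonneg: "(\<And>s. 0 \<le> f s) \<Longrightarrow> 0 \<le> killed_exp n f"
  unfolding killed_exp_def by (intro sum_nonneg) auto

lemma killed_exp_add: "killed_exp n (\<lambda>s. f s + g s) = killed_exp n f + killed_exp n g"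
  by (simp add: killed_exp_def ring_distribs sum.distrib)

lemma killed_exp_cmult: "killed_exp n (\<lambda>s. c * f s) = c * killed_exp n f"
  by (simp add: killed_exp_def sum_distrib_left mult_ac)

lemma killed_exp_1: "killed_exp (Suc 0) f = (f 1 + f (-1)) / 2"
proof -
  have "alive (Suc 0) = {[1], [-1]}"
    by (auto simp: alive_Suc image_iff)
  moreover have "{\<omega> \<in> space M. history (Suc 0) \<omega> = [x]} = {\<omega> \<in> space M. X (Suc 0) \<omega> = x}" for x
    by (auto simp: history_def)
  ultimately show ?thesis
    by (simp add: killed_exp_def prob_init[simplified])
qed

text \<open>
  Histories that return exactly at time \<open>n + 1\<close> leave \<open>alive\<close>, but \<open>f 0 = 0\<close> lets them stay in the
  sum; then every surviving history has both its extensions and the Markov property applies.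
\<close>

lemma killed_exp_Suc:
  assumes n: "n \<ge> 1" and f0: "f 0 = 0"
  shows "killed_exp (Suc n) f = killed_exp n (\<lambda>s. (1 + (2 * p - 1) * s / n) / 2 * f (s + 1)
           + (1 - (2 * p - 1) * s / n) / 2 * f (s - 1))"
proof -
  let ?w = "\<lambda>n h. prob {\<omega> \<in> space M. history n \<omega> = h}"
  have "killed_exp (Suc n) f = (\<Sum>(h, x)\<in>{(h, x) \<in> alive n \<times> {1, -1}. sum_list h + x \<noteq> 0}.
      ?w (Suc n) (h @ [x]) * f (sum_list h + x))"
    unfolding killed_exp_def alive_Suc
    by (subst sum.reindex) (auto simp: inj_on_def case_prod_unfold)
  also have "\<dots> = (\<Sum>(h, x)\<in>alive n \<times> {1, -1}. ?w (Suc n) (h @ [x]) * f (sum_list h + x))"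
    by (rule sum.mono_neutral_left) (auto simp: finite_alive f0)
  also have "\<dots> = (\<Sum>h\<in>alive n. \<Sum>x\<in>{1, -1}. ?w (Suc n) (h @ [x]) * f (sum_list h + x))"
    by (rule sum.cartesian_product[symmetric])
  also have "\<dots> = (\<Sum>h\<in>alive n. \<Sum>x\<in>{1, -1}.
      ?w n h * ((1 + (2 * p - 1) * (x * sum_list h) / n) / 2) * f (sum_list h + x))"
    using n by (intro sum.cong refl) (auto simp: alive_def prob_history_Suc)
  also have "\<dots> = killed_exp n (\<lambda>s. (1 + (2 * p - 1) * s / n) / 2 * f (s + 1)
           + (1 - (2 * p - 1) * s / n) / 2 * f (s - 1))"
    unfolding killed_exp_def
  proof (intro sum.cong refl)
    fix h assume "h \<in> alive n"
    define b where "b = (2 * p - 1) * sum_list h / n"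
    have "?w n h * ((1 + b) / 2) * f (sum_list h + 1) + ?w n h * ((1 + - b) / 2) * f (sum_list h + -1)
        = ?w n h * ((1 + b) / 2 * f (sum_list h + 1) + (1 - b) / 2 * f (sum_list h - 1))"
      by (simp add: distrib_left mult.assoc)
    then show "(\<Sum>x\<in>{1, -1}. ?w n h * ((1 + (2 * p - 1) * (x * sum_list h) / n) / 2) * f (sum_list h + x))
        = ?w n h * ((1 + (2 * p - 1) * sum_list h / n) / 2 * f (sum_list h + 1)
           + (1 - (2 * p - 1) * sum_list h / n) / 2 * f (sum_list h - 1))"
      by (simp add: b_def)
  qed
  finally show ?thesis .
qed

text \<open>
  The dynamics commute with the reflection \<open>s \<mapsto> -s\<close>.
\<close>

lemma killed_exp_abs_Suc:
  fixes f :: "real \<Rightarrow> real"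
  assumes n: "n \<ge> 1" and f0: "f 0 = 0"
  shows "killed_exp (Suc n) (\<lambda>s. f \<bar>real_of_int s\<bar>) = killed_exp n (\<lambda>s.
           (1 + (2 * p - 1) * \<bar>real_of_int s\<bar> / n) / 2 * f (\<bar>real_of_int s\<bar> + 1)
           + (1 - (2 * p - 1) * \<bar>real_of_int s\<bar> / n) / 2 * f (\<bar>real_of_int s\<bar> - 1))"
proof -
  have "killed_exp (Suc n) (\<lambda>s. f \<bar>real_of_int s\<bar>) = killed_exp n (\<lambda>s.
           (1 + (2 * p - 1) * s / n) / 2 * f \<bar>real_of_int (s + 1)\<bar>
           + (1 - (2 * p - 1) * s / n) / 2 * f \<bar>real_of_int (s - 1)\<bar>)"
    by (rule killed_exp_Suc[OF n]) (simp add: f0)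
  also have "\<dots> = killed_exp n (\<lambda>s.
           (1 + (2 * p - 1) * \<bar>real_of_int s\<bar> / n) / 2 * f (\<bar>real_of_int s\<bar> + 1)
           + (1 - (2 * p - 1) * \<bar>real_of_int s\<bar> / n) / 2 * f (\<bar>real_of_int s\<bar> - 1))"
  proof (rule killed_exp_cong[OF n])
    fix s :: int assume "s \<noteq> 0"
    then consider "s \<ge> 1" | "s \<le> -1" by linarith
    then show "(1 + (2 * p - 1) * s / n) / 2 * f \<bar>real_of_int (s + 1)\<bar>
             + (1 - (2 * p - 1) * s / n) / 2 * f \<bar>real_of_int (s - 1)\<bar>
           = (1 + (2 * p - 1) * \<bar>real_of_int s\<bar> / n) / 2 * f (\<bar>real_of_int s\<bar> + 1)
             + (1 - (2 * p - 1) * \<bar>real_of_int s\<bar> / n) / 2 * f (\<bar>real_of_int s\<bar> - 1)"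
    proof cases
      case 1
      then show ?thesis by simp
    next
      case 2
      then have "\<bar>real_of_int (s + 1)\<bar> = \<bar>real_of_int s\<bar> - 1"
        "\<bar>real_of_int (s - 1)\<bar> = \<bar>real_of_int s\<bar> + 1"
        by linarith+
      moreover from 2 have "(2 * p - 1) * s / n = - ((2 * p - 1) * \<bar>real_of_int s\<bar> / n)"
        by simp
      ultimately show ?thesis by (simp only: diff_minus_eq_add add_uminus_conv_diff add.commute)
    qed
  qed
  finally show ?thesis .
qed

section \<open>The mean return time as a series\<close>

text \<open>The probability that the walk has not returned by time \<open>n\<close>; see \<open>emeasure_return_gt\<close>.\<close>

definition survival :: "nat \<Rightarrow> real" where
  "survival n = killed_exp n (\<lambda>_. 1)"

lemma survival_nonneg: "0 \<le> survival n"
  by (simp add: survival_def killed_exp_nonneg)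

lemma emeasure_return_gt:
  "emeasure M {\<omega> \<in> space M. enat n < first_return (erw_position X) \<omega>} = ennreal (survival n)"
proof -
  have gt: "enat n < first_return S \<omega> \<longleftrightarrow> (\<forall>j\<in>{1..n}. S j \<omega> \<noteq> 0)" for S and \<omega> :: 'a
  proof -
    have "enat n < first_return S \<omega> \<longleftrightarrow> (\<forall>j. j \<ge> 1 \<and> S j \<omega> = 0 \<longrightarrow> enat (Suc n) \<le> enat j)"
      unfolding first_return_def Suc_ile_eq[symmetric] le_Inf_iff by blast
    also have "\<dots> \<longleftrightarrow> (\<forall>j\<in>{1..n}. S j \<omega> \<noteq> 0)"
      by (auto simp: not_le Suc_le_eq)
    finally show ?thesis .
  qed
  have "{\<omega> \<in> space M. \<forall>j\<in>{1..n}. erw_position X j \<omega> \<noteq> 0}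
      = {\<omega> \<in> space M. \<forall>j\<in>{1..n}. sum_list (take j (history n \<omega>)) \<noteq> 0}"
    by (auto simp: take_history sum_list_history)
  also have "prob \<dots> = prob (\<Union>h\<in>alive n. {\<omega> \<in> space M. history n \<omega> = h})"
  proof (rule finite_measure_eq_AE)
    show "AE \<omega> in M. (\<omega> \<in> {\<omega> \<in> space M. \<forall>j\<in>{1..n}. sum_list (take j (history n \<omega>)) \<noteq> 0})
        = (\<omega> \<in> (\<Union>h\<in>alive n. {\<omega> \<in> space M. history n \<omega> = h}))"
      using AE_history_signs[of n] by eventually_elim (auto simp: alive_def)
  qed (auto simp: finite_alive)
  also have "\<dots> = survival n"
    unfolding survival_def killed_exp_def
    by (subst finite_measure_finite_Union) (auto simp: finite_alive disjoint_family_on_def)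
  finally show ?thesis by (simp add: gt emeasure_eq_measure)
qed

lemma measurable_first_return:
  "first_return (erw_position X) \<in> measurable M (count_space UNIV)"
proof -
  have [measurable]: "(\<lambda>\<omega>. erw_position X n \<omega>) \<in> measurable M (count_space UNIV)" for n
    unfolding sum_list_history[symmetric] by measurable
  have "first_return S \<omega> = (if \<exists>j. j \<ge> 1 \<and> S j \<omega> = 0
      then enat (LEAST j. j \<ge> 1 \<and> S j \<omega> = 0) else \<infinity>)" for S and \<omega> :: 'a
  proof (cases "\<exists>j. j \<ge> 1 \<and> S j \<omega> = 0")
    case True
    then have "1 \<le> (LEAST j. j \<ge> 1 \<and> S j \<omega> = 0) \<and> S (LEAST j. j \<ge> 1 \<and> S j \<omega> = 0) \<omega> = 0"
      by (rule LeastI_ex)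
    then show ?thesis
      using True unfolding first_return_def
      by (auto intro!: antisym Inf_lower Inf_greatest Least_le)
  next
    case False
    then have "{enat j |j. j \<ge> 1 \<and> S j \<omega> = 0} = {}" by blast
    then have "first_return S \<omega> = Inf {}" by (simp only: first_return_def)
    then show ?thesis using False by (simp add: top_enat_def)
  qed
  then have *: "first_return (erw_position X) = (\<lambda>\<omega>. if \<exists>j. j \<ge> 1 \<and> erw_position X j \<omega> = 0
      then enat (LEAST j. j \<ge> 1 \<and> erw_position X j \<omega> = 0) else \<infinity>)"
    by (rule ext)
  show ?thesis unfolding * by measurable
qed

lemma expected_return_finite_iff:
  "(\<integral>\<^sup>+ \<omega>. ennreal_of_enat (first_return (erw_position X) \<omega>) \<partial>M) < \<infinity> \<longleftrightarrow> summable survival"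
proof -
  have "(\<integral>\<^sup>+ \<omega>. ennreal_of_enat (first_return (erw_position X) \<omega>) \<partial>M) = (\<Sum>n. ennreal (survival n))"
    by (simp add: nn_integral_enat_function[OF measurable_first_return] emeasure_return_gt)
  moreover have "(\<Sum>n. ennreal (survival n)) < \<infinity> \<longleftrightarrow> summable survival"
  proof
    assume "(\<Sum>n. ennreal (survival n)) < \<infinity>"
    then show "summable survival"
      by (intro summable_suminf_not_top survival_nonneg) auto
  next
    assume "summable survival"
    then show "(\<Sum>n. ennreal (survival n)) < \<infinity>"
      by (subst suminf_ennreal2) (auto simp: survival_nonneg)
  qed
  ultimately show ?thesis by simp
qed

section \<open>Divergence for \<open>p \<ge> 1 / 4\<close>\<close>

text \<open>
  Away from the origin \<open>\<bar>s\<bar>\<close> has no second difference, so only the drift contributes and the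
  recursion is an equality.
\<close>

lemma killed_exp_abs:
  assumes "n \<ge> 1"
  shows "killed_exp (Suc n) (\<lambda>s. \<bar>real_of_int s\<bar>) = (1 + (2 * p - 1) / n) * killed_exp n (\<lambda>s. \<bar>real_of_int s\<bar>)"
proof -
  have "killed_exp (Suc n) (\<lambda>s. \<bar>real_of_int s\<bar>) = killed_exp n (\<lambda>s. (1 + (2 * p - 1) / n) * \<bar>real_of_int s\<bar>)"
    unfolding killed_exp_abs_Suc[OF assms, of "\<lambda>x. x", simplified]
    using assms by (intro killed_exp_cong) (auto simp: field_simps)
  then show ?thesis by (simp add: killed_exp_cmult)
qed

lemma killed_exp_square:
  assumes "n \<ge> 1"
  shows "killed_exp (Suc n) (\<lambda>s. (real_of_int s)\<^sup>2) = (1 + 2 * (2 * p - 1) / n) * killed_exp n (\<lambda>s. (real_of_int s)\<^sup>2) + survival n"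
proof -
  have "killed_exp (Suc n) (\<lambda>s. (real_of_int s)\<^sup>2) = killed_exp n (\<lambda>s. (1 + 2 * (2 * p - 1) / n) * (real_of_int s)\<^sup>2 + 1)"
    unfolding killed_exp_Suc[OF assms, of "\<lambda>x. x\<^sup>2", simplified]
    using assms by (intro killed_exp_cong) (auto simp: field_simps power2_eq_square)
  then show ?thesis by (simp add: killed_exp_cmult killed_exp_add survival_def)
qed

lemma killed_exp_Cauchy_Schwarz:
  "(killed_exp n (\<lambda>s. \<bar>real_of_int s\<bar>))\<^sup>2 \<le> killed_exp n (\<lambda>s. (real_of_int s)\<^sup>2) * survival n"
proof -
  let ?w = "\<lambda>h. prob {\<omega> \<in> space M. history n \<omega> = h}"
  have "(\<Sum>h\<in>alive n. (sqrt (?w h) * \<bar>sum_list h\<bar>) * sqrt (?w h))\<^sup>2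
      \<le> (\<Sum>h\<in>alive n. (sqrt (?w h) * \<bar>sum_list h\<bar>)\<^sup>2) * (\<Sum>h\<in>alive n. (sqrt (?w h))\<^sup>2)"
    by (rule Cauchy_Schwarz_ineq_sum)
  moreover have "(sqrt (?w h) * \<bar>sum_list h\<bar>) * sqrt (?w h) = ?w h * \<bar>real_of_int (sum_list h)\<bar>" for h
    by (simp add: mult.commute mult.left_commute)
  moreover have "(sqrt (?w h) * \<bar>sum_list h\<bar>)\<^sup>2 = ?w h * (real_of_int (sum_list h))\<^sup>2" for h
    by (simp add: power_mult_distrib)
  moreover have "(sqrt (?w h))\<^sup>2 = ?w h * 1" for h
    by simp
  ultimately show ?thesis
    by (simp only: killed_exp_def survival_def)
qed

text \<open>
  The walk moves by one in each step, so \<open>\<bar>S n\<bar> \<le> n\<close>, and a first moment of at least 1 on survival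
  forces the survival probability to be at least \<open>1 / n\<close>.
\<close>

lemma survival_not_summable_if_half_le:
  assumes "1 / 2 \<le> p"
  shows "\<not> summable survival"
proof
  assume "summable survival"
  have one: "1 \<le> killed_exp n (\<lambda>s. \<bar>real_of_int s\<bar>)" if "n \<ge> 1" for n
    using that
  proof (induction n rule: dec_induct)
    case (step n)
    have "1 * 1 \<le> (1 + (2 * p - 1) / n) * killed_exp n (\<lambda>s. \<bar>real_of_int s\<bar>)"
      using step assms by (intro mult_mono) auto
    then show ?case using step by (simp add: killed_exp_abs)
  qed (simp add: killed_exp_1)
  have "norm (inverse (real n)) \<le> survival n" if "n \<ge> 1" for n
  proof -
    have "killed_exp n (\<lambda>s. \<bar>real_of_int s\<bar>) \<le> killed_exp n (\<lambda>s. real n * 1)"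
      using that by (intro killed_exp_mono) auto
    also have "\<dots> = real n * survival n"
      by (simp only: killed_exp_cmult survival_def)
    finally show ?thesis using one[OF that] that by (simp add: field_simps)
  qed
  with \<open>summable survival\<close> have "summable (\<lambda>n. inverse (real n))"
    by (rule summable_comparison_test'[where N = 1])
  then show False using not_summable_harmonic by blast
qed

text \<open>
  If the series converged, its sum would bound the second moment on survival: a step adds the
  current survival probability to that moment, and the drift towards the origin only subtracts. With a first moment of order at least
  \<open>n powr (- 1 / 2)\<close>, Cauchy-Schwarz then bounds the survival probability below by a multiple of \<open>1 / n\<close>.
\<close>

lemma survival_not_summable_if_quarter_le:
  assumes "1 / 4 \<le> p" "p \<le> 1 / 2"
  shows "\<not> summable survival"
proof
  assume sum: "summable survival"
  define Q where "Q = 1 + suminf survival"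
  have second: "killed_exp n (\<lambda>s. (real_of_int s)\<^sup>2) \<le> 1 + (\<Sum>k<n. survival k)" if "n \<ge> 1" for n
    using that
  proof (induction n rule: dec_induct)
    case base
    then show ?case by (simp add: killed_exp_1 survival_nonneg)
  next
    case (step n)
    have "(1 + 2 * (2 * p - 1) / n) * killed_exp n (\<lambda>s. (real_of_int s)\<^sup>2) \<le> 1 * killed_exp n (\<lambda>s. (real_of_int s)\<^sup>2)"
      using assms step by (intro mult_right_mono killed_exp_nonneg) (auto simp: field_simps)
    then show ?case using step by (simp add: killed_exp_square)
  qed
  have Q: "killed_exp n (\<lambda>s. (real_of_int s)\<^sup>2) \<le> Q" if "n \<ge> 1" for n
    using second[OF that] sum_le_suminf[OF sum, of "{..<n}"] survival_nonneg
    by (auto simp: Q_def)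
  have Qpos: "0 < Q" using sum by (simp add: Q_def suminf_nonneg survival_nonneg add_pos_nonneg)
  \<comment> \<open>The growth factor at time \<open>m\<close> is at least \<open>1 - 1 / (2 * m)\<close>, its value for \<open>p = 1 / 4\<close>. The square
      of this is at least \<open>(m - 1) / m\<close>, and the product of these ratios telescopes. The induction starts at time 2 because
      this ratio vanishes for \<open>m = 1\<close>.\<close>
  have first: "1 / 4 \<le> n * (killed_exp (Suc n) (\<lambda>s. \<bar>real_of_int s\<bar>))\<^sup>2" if "n \<ge> 1" for n
    using that
  proof (induction n rule: dec_induct)
    case base
    have "(1 / 2)\<^sup>2 \<le> (2 * p)\<^sup>2" using assms by (intro power_mono) auto
    then show ?case
      using killed_exp_abs[of 1] killed_exp_1[of "\<lambda>s. \<bar>s\<bar>"]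
      by (simp add: power2_eq_square numeral_2_eq_2)
  next
    case (step n)
    define m where "m = real (Suc n)"
    have m: "1 \<le> m" by (simp add: m_def)
    have "(1 - 1 / (2 * m))\<^sup>2 \<le> (1 + (2 * p - 1) / m)\<^sup>2"
      using assms m by (intro power_mono) (auto simp: field_simps)
    moreover have "m - 1 \<le> m * (1 - 1 / (2 * m))\<^sup>2"
      using m by (simp add: field_simps power2_eq_square)
    moreover have "m - 1 = real n" by (simp add: m_def)
    moreover have "0 \<le> m" using m by simp
    ultimately have "real n \<le> m * (1 + (2 * p - 1) / m)\<^sup>2"
      using mult_left_mono[of "(1 - 1 / (2 * m))\<^sup>2" "(1 + (2 * p - 1) / m)\<^sup>2" m] by linarith
    then have "real n * (killed_exp (Suc n) (\<lambda>s. \<bar>real_of_int s\<bar>))\<^sup>2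
        \<le> m * (1 + (2 * p - 1) / m)\<^sup>2 * (killed_exp (Suc n) (\<lambda>s. \<bar>real_of_int s\<bar>))\<^sup>2"
      by (rule mult_right_mono) simp
    then show ?case
      using step.IH killed_exp_abs[of "Suc n"] by (simp add: m_def power_mult_distrib mult_ac)
  qed
  have "norm (inverse (real n)) \<le> 4 * Q * survival (Suc n)" if n: "n \<ge> 1" for n
  proof -
    have "1 / (4 * n) \<le> (killed_exp (Suc n) (\<lambda>s. \<bar>real_of_int s\<bar>))\<^sup>2"
      using first[OF n] n by (simp add: field_simps)
    also have "\<dots> \<le> killed_exp (Suc n) (\<lambda>s. (real_of_int s)\<^sup>2) * survival (Suc n)"
      by (rule killed_exp_Cauchy_Schwarz)
    also have "\<dots> \<le> Q * survival (Suc n)"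
      by (intro mult_right_mono Q survival_nonneg) simp
    finally show ?thesis using n by (simp add: field_simps)
  qed
  moreover have "summable (\<lambda>n. 4 * Q * survival (Suc n))"
    using sum by (intro summable_mult) (subst summable_Suc_iff)
  ultimately have "summable (\<lambda>n. inverse (real n))"
    using summable_comparison_test'[of "\<lambda>n. 4 * Q * survival (Suc n)" 1 "\<lambda>n. inverse (real n)"]
    by blast
  then show False using not_summable_harmonic by blast
qed

section \<open>Convergence for \<open>p < 1 / 4\<close>\<close>

text \<open>
  Summing the decrease of the Lyapunov function over all times before the return.
\<close>

lemma survival_summable:
  assumes "0 \<le> p" "p < 1 / 4"
  shows "summable survival"
proof -
  define a where "a = 2 * p - 1"
  have a: "-1 \<le> a" "a < -1 / 2" unfolding a_def using assms by linarith+
  then have a2: "1 < 1 / 2 - a" by linarith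
  \<comment> \<open>This is where \<open>p < 1 / 4\<close> enters: it leaves room for an exponent below 1.\<close>
  have "1 / (1 / 2 - a) < 1"
    using divide_less_eq_1_pos[of "1 / 2 - a" 1] a2 by linarith
  then obtain \<gamma> where \<gamma>1: "1 / (1 / 2 - a) < \<gamma>" "\<gamma> < 1" using dense by blast
  have "0 < 1 / (1 / 2 - a)" using a2 by simp
  with \<gamma>1(1) have \<gamma>0: "0 < \<gamma>" by linarith
  have \<delta>: "1 < \<gamma> * (1 / 2 - a)" using \<gamma>1(1) a2 by (simp add: pos_divide_less_eq)
  define c where "c = min (\<gamma> * (1 / 2 - a) - 1) (\<gamma> * (1 - \<gamma>) / 4)"
  have c: "0 < c" using \<delta> \<gamma>1 \<gamma>0 by (simp add: c_def)
  define V where "V n = killed_exp n (\<lambda>s. real n powr (1 - \<gamma> / 2) * \<bar>real_of_int s\<bar> powr \<gamma>)" for n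
  have drift: "V (Suc n) + c * survival n \<le> V n" if n: "n \<ge> 1" for n
  proof -
    have "V (Suc n) = killed_exp n (\<lambda>s.
        (1 + a * \<bar>real_of_int s\<bar> / n) / 2 * (real (Suc n) powr (1 - \<gamma> / 2) * (\<bar>real_of_int s\<bar> + 1) powr \<gamma>)
         + (1 - a * \<bar>real_of_int s\<bar> / n) / 2 * (real (Suc n) powr (1 - \<gamma> / 2) * (\<bar>real_of_int s\<bar> - 1) powr \<gamma>))"
      unfolding V_def a_def
      by (rule killed_exp_abs_Suc[OF n, of "\<lambda>y. real (Suc n) powr (1 - \<gamma> / 2) * y powr \<gamma>"]) simp
    moreover have "c * survival n = killed_exp n (\<lambda>_. c * 1)"
      unfolding survival_def by (rule killed_exp_cmult[symmetric])
    ultimately have "V (Suc n) + c * survival n = killed_exp n (\<lambda>s.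
        ((1 + a * \<bar>real_of_int s\<bar> / n) / 2 * (real (Suc n) powr (1 - \<gamma> / 2) * (\<bar>real_of_int s\<bar> + 1) powr \<gamma>)
         + (1 - a * \<bar>real_of_int s\<bar> / n) / 2 * (real (Suc n) powr (1 - \<gamma> / 2) * (\<bar>real_of_int s\<bar> - 1) powr \<gamma>)) + c * 1)"
      by (simp only: killed_exp_add)
    also have "\<dots> \<le> killed_exp n (\<lambda>s. real n powr (1 - \<gamma> / 2) * \<bar>real_of_int s\<bar> powr \<gamma>)"
    proof (rule killed_exp_mono[OF n])
      fix s :: int assume s: "s \<noteq> 0" "\<bar>s\<bar> \<le> int n"
      have x: "1 \<le> \<bar>real_of_int s\<bar>" "\<bar>real_of_int s\<bar> \<le> real n" using s by linarith+
      have factor_out: "P * (A * B + C * D) = A * (P * B) + C * (P * D)" for P A B C D :: real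
        by (simp add: algebra_simps)
      have "a \<le> 0" using a by linarith
      from lyapunov_drift[OF a(1) this \<gamma>0 \<gamma>1(2) x \<delta>]
      have "(1 + a * \<bar>real_of_int s\<bar> / n) / 2 * (real (Suc n) powr (1 - \<gamma> / 2) * (\<bar>real_of_int s\<bar> + 1) powr \<gamma>)
         + (1 - a * \<bar>real_of_int s\<bar> / n) / 2 * (real (Suc n) powr (1 - \<gamma> / 2) * (\<bar>real_of_int s\<bar> - 1) powr \<gamma>)
         \<le> real n powr (1 - \<gamma> / 2) * \<bar>real_of_int s\<bar> powr \<gamma> - c"
        unfolding factor_out c_def .
      then show "((1 + a * \<bar>real_of_int s\<bar> / n) / 2 * (real (Suc n) powr (1 - \<gamma> / 2) * (\<bar>real_of_int s\<bar> + 1) powr \<gamma>)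
         + (1 - a * \<bar>real_of_int s\<bar> / n) / 2 * (real (Suc n) powr (1 - \<gamma> / 2) * (\<bar>real_of_int s\<bar> - 1) powr \<gamma>)) + c * 1
         \<le> real n powr (1 - \<gamma> / 2) * \<bar>real_of_int s\<bar> powr \<gamma>"
        unfolding mult_1_right le_diff_eq .
    qed
    finally show ?thesis by (simp only: V_def)
  qed
  have tel: "c * (\<Sum>k=1..<n. survival k) + V n \<le> V 1" if "n \<ge> 1" for n
    using that
  proof (induction n rule: dec_induct)
    case (step n)
    then show ?case using drift[of n] by (simp add: algebra_simps)
  qed simp
  have "(\<Sum>k\<le>n. survival (Suc k)) \<le> V 1 / c" for n
  proof -
    have "0 \<le> V (n + 2)" by (auto simp: V_def intro!: killed_exp_nonneg)
    then have "c * (\<Sum>k=1..<n + 2. survival k) \<le> V 1" using tel[of "n + 2"] by linarith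
    moreover have "(\<Sum>k=1..<n + 2. survival k) = (\<Sum>k\<le>n. survival (Suc k))"
      by (rule sum.reindex_bij_witness[of _ Suc "\<lambda>k. k - 1"]) auto
    ultimately show ?thesis using c by (simp only: pos_le_divide_eq mult.commute)
  qed
  then have "summable (\<lambda>k. survival (Suc k))"
    by (intro bounded_imp_summable[of _ "V 1 / c"] survival_nonneg)
  then show ?thesis by (simp add: summable_Suc_iff)
qed

end

theorem mainTheorem4:
  fixes M :: "'a measure" and p :: real
    and X :: "nat \<Rightarrow> 'a \<Rightarrow> int" and u :: "nat \<Rightarrow> 'a \<Rightarrow> nat" and \<epsilon> :: "nat \<Rightarrow> 'a \<Rightarrow> int"
  assumes "0 \<le> p" and "p < 3/4"
    and "elephant_random_walk M p X u \<epsilon>"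
  shows "(\<integral>\<^sup>+ \<omega>. ennreal_of_enat (first_return (erw_position X) \<omega>) \<partial>M) < \<infinity> \<longleftrightarrow> p < 1/4"
proof -
  interpret elephant_random_walk M p X u \<epsilon> by fact
  show ?thesis
    unfolding expected_return_finite_iff
    using survival_summable survival_not_summable_if_quarter_le survival_not_summable_if_half_le \<open>0 \<le> p\<close>
    by (meson linorder_le_cases not_le)
qed

end
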